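(* Let $0<\alpha<1$, $n\ge 1$, $A\in\mathbb{R}^{n\times n}$, $T>0$, and let $\zeta\in\mathbb{C}$ be a zero of the Mittag-Leffler function $E_\alpha(z)$. If $\frac{\zeta}{T^\alpha}$ is an eigenvalue of $A$, then: (i) $\ker\{E_\alpha(T^\alpha A)\}\neq\{0\}$ (kernel in $\mathbb{R}^n$); (ii) for every $z_0\in\ker\{E_\alpha(T^\alpha A)\}$ and every $p$ in the image $\{E_\alpha(T^\alpha A)x : x\in\mathbb{R}^n\}$, there exists $x_0\in\mathbb{R}^n$ such that $u(T;x_0+z_0)=p$.
   Context: The Mittag-Leffler function is $E_{\alpha}(z)=\sum_{k=0}^{\infty}\frac{z^k}{\Gamma(\alpha k+1)}$, $z\in\mathbb{C}$, and for a square matrix $M$, $E_\alpha(M)=\sum_{k=0}^\infty \frac{M^k}{\Gamma(\alpha k+1)}$. The fractional initial value problem $D^\alpha x(t)=Ax(t)$, $t\ge 0$, $x(0)=x_0$ (Caputo derivative of order $\alpha$) has the unique solution $u(t;x_0):=E_\alpha(t^\alpha A)x_0$, $t\ge 0$, called the trajectory starting at $x_0$. *)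

theory Defs
  imports "HOL-Analysis.Analysis"
begin

definition mittag_leffler :: "real \<Rightarrow> complex \<Rightarrow> complex" where
  "mittag_leffler \<alpha> z = (\<Sum>k. z ^ k / of_real (Gamma (\<alpha> * real k + 1)))"

(* The library operations * and ^ on the type of vectors act componentwise, also on
   matrices, so powers with respect to the matrix product need a separate definition. *)
primrec matrix_power :: "'a::semiring_1^'n^'n \<Rightarrow> nat \<Rightarrow> 'a^'n^'n" where
  "matrix_power M 0 = mat 1"
| "matrix_power M (Suc k) = M ** matrix_power M k"

definition mittag_leffler_matrix ::
  "real \<Rightarrow> 'a::real_normed_field^'n^'n \<Rightarrow> 'a^'n^'n" where
  "mittag_leffler_matrix \<alpha> M =
     (\<Sum>k. (1 / Gamma (\<alpha> * real k + 1)) *\<^sub>R matrix_power M k)"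

(* Eigenvalues of a real matrix are the complex ones, with eigenvectors in complex n-space. *)
definition complex_eigenvalue :: "real^'n^'n \<Rightarrow> complex \<Rightarrow> bool" where
  "complex_eigenvalue A \<mu> \<longleftrightarrow>
     (\<exists>v :: complex^'n. v \<noteq> 0 \<and> map_matrix complex_of_real A *v v = \<mu> *s v)"

(* The solution at time t of the Caputo initial value problem D^alpha x = A x, x(0) = x0,
   in its closed form E_alpha(t^alpha A) x0. At t = 0 it is x0 since 0 powr alpha = 0. *)
definition trajectory :: "real \<Rightarrow> real^'n^'n \<Rightarrow> real \<Rightarrow> real^'n \<Rightarrow> real^'n" where
  "trajectory \<alpha> A t x0 = mittag_leffler_matrix \<alpha> ((t powr \<alpha>) *\<^sub>R A) *v x0"

definition matrix_kernel :: "real^'n^'m \<Rightarrow> (real^'n) set" where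
  "matrix_kernel M = {x. M *v x = 0}"

end

theory Submission
  imports Defs
begin

text \<open>
  Put \<open>M = T powr \<alpha> *\<^sub>R A\<close>, so that \<open>\<zeta>\<close> is an eigenvalue of \<open>M\<close>, with a complex
  eigenvector \<open>v\<close>. Each power \<open>M ^ k\<close> multiplies \<open>v\<close> by \<open>\<zeta> ^ k\<close>, so summing the
  Mittag-Leffler series shows that \<open>E_\<alpha>(M)\<close> multiplies \<open>v\<close> by \<open>E_\<alpha>(\<zeta>) = 0\<close>
  (\<open>mittag_leffler_matrix_eigenvector\<close>). As \<open>E_\<alpha>(M)\<close> is a real matrix, it annihilates
  the real and the imaginary part of \<open>v\<close> separately, and one of them is nonzero
  (\<open>matrix_kernel_nontrivial_if_complex\<close>). That gives the kernel. The second claim is linearity: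
  the trajectory at time \<open>T\<close> is \<open>E_\<alpha>(M)\<close> applied to the initial value, so adding a kernel
  element to a preimage of \<open>p\<close> leaves the end point \<open>p\<close> unchanged.

  The analytic content is that the series converge, without which the infinite sums
  are not tied to their terms. This needs \<open>Gamma (\<alpha> * k + 1)\<close> to outgrow every geometric
  sequence, which follows from the Euler integral (\<open>Gamma_ge_power\<close>). The matrix series is then
  dominated, up to a dimensional factor, by the scalar series at the operator norm of the matrix.
\<close>

section \<open>Convergence of the Mittag-Leffler series\<close>

text \<open>
  The integrand of the Euler integral is nonnegative, and on the unit interval from \<open>R\<close> to
  \<open>R + 1\<close> it is at least the left-hand side. Since \<open>R\<close> is arbitrary, the Gamma function
  grows faster than any exponential.
\<close>

lemma Gamma_ge_power:
  fixes x R :: real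
  assumes "x \<ge> 0" "R > 0"
  shows "R powr x * exp (- (R + 1)) \<le> Gamma (x + 1)"
proof -
  have G: "((\<lambda>t. t powr x / exp t) has_integral Gamma (x + 1)) {0..}"
    using Gamma_integral_real[of "x + 1"] assms by simp
  have "((\<lambda>_. R powr x * exp (- (R + 1))) has_integral R powr x * exp (- (R + 1))) {R..R+1}"
    using has_integral_const_real[of "R powr x * exp (- (R + 1))" R "R + 1"] by simp
  moreover have "((\<lambda>t. t powr x / exp t) has_integral
      integral {R..R+1} (\<lambda>t. t powr x / exp t)) {R..R+1}"
    using assms by (intro integrable_integral integrable_continuous_real continuous_intros) auto
  moreover have "R powr x * exp (- (R + 1)) \<le> t powr x / exp t" if "t \<in> {R..R+1}" for t
  proof -
    have "R powr x * exp (- (R + 1)) \<le> t powr x * exp (- t)"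
      using that assms by (intro mult_mono powr_mono2) auto
    then show ?thesis by (simp add: exp_minus field_simps)
  qed
  ultimately have "R powr x * exp (- (R + 1)) \<le> integral {R..R+1} (\<lambda>t. t powr x / exp t)"
    by (rule has_integral_le)
  also have "\<dots> \<le> integral {0..} (\<lambda>t. t powr x / exp t)"
    using assms G
    by (intro integral_subset_le integrable_continuous_real continuous_intros) auto
  also have "\<dots> = Gamma (x + 1)" using G by (rule integral_unique)
  finally show ?thesis .
qed

text \<open>
  Both the scalar series, with \<open>r\<close> the modulus of the argument, and the matrix series, with \<open>r\<close>
  the operator norm, are compared with this one.
\<close>

lemma summable_mittag_leffler_majorant:
  fixes \<alpha> r :: real
  assumes "\<alpha> > 0" "r \<ge> 0"
  shows "summable (\<lambda>k. r ^ k / Gamma (\<alpha> * real k + 1))"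
proof -
  \<comment> \<open>The choice of \<open>R\<close> makes \<open>R powr (\<alpha> * k)\<close> at least \<open>2 ^ k * r ^ k\<close>, which leaves a geometric
    series of ratio \<open>1 / 2\<close>; \<open>r + 1\<close> replaces \<open>r\<close> so that \<open>R\<close> is positive even if \<open>r = 0\<close>.\<close>
  define R where "R = (2 * (r + 1)) powr (1 / \<alpha>)"
  have R: "R > 0" "R powr \<alpha> = 2 * (r + 1)"
    using assms by (auto simp: R_def powr_powr)
  have pos: "\<alpha> * real k + 1 > 0" for k
    using assms by (simp add: add_nonneg_pos)
  have "r ^ k / Gamma (\<alpha> * real k + 1) \<le> exp (R + 1) * (1 / 2) ^ k" for k
  proof -
    have "(2 * (r + 1)) ^ k = R powr (\<alpha> * real k)"
      using assms R by (simp add: powr_powr[symmetric] powr_realpow)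
    then have *: "(2 * (r + 1)) ^ k * exp (- (R + 1)) \<le> Gamma (\<alpha> * real k + 1)"
      using Gamma_ge_power[of "\<alpha> * real k" R] assms R by simp
    have "r ^ k / Gamma (\<alpha> * real k + 1) \<le> (r + 1) ^ k / ((2 * (r + 1)) ^ k * exp (- (R + 1)))"
      using assms * by (intro frac_le power_mono mult_pos_pos) auto
    also have "\<dots> = exp (R + 1) * (1 / 2) ^ k"
      using assms by (simp only: power_mult_distrib exp_minus) (simp add: field_simps)
    finally show ?thesis .
  qed
  moreover have "0 \<le> r ^ k / Gamma (\<alpha> * real k + 1)" for k
    using assms pos[of k] by (intro divide_nonneg_nonneg Gamma_real_nonneg) auto
  ultimately have norm_le: "norm (r ^ k / Gamma (\<alpha> * real k + 1)) \<le> exp (R + 1) * (1 / 2) ^ k" for k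
    by (simp only: real_norm_def abs_of_nonneg)
  have "summable (\<lambda>k. exp (R + 1) * (1 / 2 :: real) ^ k)"
    by (rule summable_mult[OF summable_geometric]) simp
  then show ?thesis
    by (rule summable_comparison_test'[of _ 0]) (rule norm_le)
qed

text \<open>
  The operator norm is submultiplicative, which suits powers of matrices; convergence of matrix
  series refers to the norm of the vector type. This comparison passes from one to the other.
\<close>

lemma norm_matrix_le_onorm:
  fixes M :: "real^'n^'m"
  shows "norm M \<le> real (CARD('m) * CARD('n)) * onorm ((*v) M)"
proof -
  have "norm M \<le> (\<Sum>i\<in>UNIV. norm (M $ i))"
    by (simp add: norm_vec_def L2_set_le_sum)
  also have "\<dots> \<le> (\<Sum>i\<in>(UNIV::'m set). \<Sum>j\<in>(UNIV::'n set). \<bar>M $ i $ j\<bar>)"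
    by (intro sum_mono norm_le_l1_cart)
  also have "\<dots> \<le> (\<Sum>i\<in>(UNIV::'m set). \<Sum>j\<in>(UNIV::'n set). onorm ((*v) M))"
    by (intro sum_mono matrix_component_le_onorm)
  finally show ?thesis by simp
qed

lemma onorm_matrix_power_le:
  fixes M :: "real^'n^'n"
  shows "onorm ((*v) (matrix_power M k)) \<le> onorm ((*v) M) ^ k"
proof (induction k)
  case 0
  show ?case by (simp add: onorm_id_le[unfolded id_def])
next
  case (Suc k)
  have "onorm ((*v) (matrix_power M (Suc k)))
      = onorm ((*v) M \<circ> (*v) (matrix_power M k))"
    by (simp add: o_def matrix_vector_mul_assoc)
  also have "\<dots> \<le> onorm ((*v) M) * onorm ((*v) (matrix_power M k))"
    by (intro onorm_compose matrix_vector_mul_bounded_linear)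
  also have "\<dots> \<le> onorm ((*v) M) * onorm ((*v) M) ^ k"
    by (intro mult_left_mono Suc onorm_pos_le matrix_vector_mul_bounded_linear)
  finally show ?case by simp
qed

lemma summable_mittag_leffler_matrix:
  fixes M :: "real^'n^'n"
  assumes "\<alpha> > 0"
  shows "summable (\<lambda>k. (1 / Gamma (\<alpha> * real k + 1)) *\<^sub>R matrix_power M k)"
proof (rule summable_comparison_test')
  let ?C = "real (CARD('n) * CARD('n))" and ?r = "onorm ((*v) M)"
  show "summable (\<lambda>k. ?C * (?r ^ k / Gamma (\<alpha> * real k + 1)))"
    by (rule summable_mult[OF summable_mittag_leffler_majorant[OF assms
          onorm_pos_le[OF matrix_vector_mul_bounded_linear]]])
  fix k :: nat
  have "norm (matrix_power M k) \<le> ?C * ?r ^ k"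
    by (rule order_trans[OF norm_matrix_le_onorm mult_left_mono[OF onorm_matrix_power_le]]) simp
  moreover have G: "Gamma (\<alpha> * real k + 1) > 0"
    using assms by (intro Gamma_real_pos) (simp add: add_nonneg_pos)
  ultimately show "norm ((1 / Gamma (\<alpha> * real k + 1)) *\<^sub>R matrix_power M k)
      \<le> ?C * (?r ^ k / Gamma (\<alpha> * real k + 1))"
    by (simp add: divide_right_mono)
qed

section \<open>Eigenvectors and kernels\<close>

lemma complexify_matrix_power_eigenvector:
  fixes M :: "real^'n^'n"
  assumes "map_matrix complex_of_real M *v v = \<mu> *s v"
  shows "map_matrix complex_of_real (matrix_power M k) *v v = \<mu> ^ k *s v"
proof (induction k)
  case 0
  have "map_matrix complex_of_real (mat 1 :: real^'n^'n) = mat 1"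
    by (simp add: vec_eq_iff map_matrix_def mat_def)
  then show ?case by simp
next
  case (Suc k)
  have "map_matrix complex_of_real (M ** matrix_power M k)
      = map_matrix complex_of_real M ** map_matrix complex_of_real (matrix_power M k)"
    by (simp add: vec_eq_iff map_matrix_def matrix_matrix_mult_def)
  then show ?case
    using assms
    by (simp add: matrix_vector_mul_assoc[symmetric] Suc vector_scalar_commute mult.commute)
qed

text \<open>
  Complexifying a real matrix and applying it to the fixed vector \<open>v\<close> is a real-linear map out
  of a finite-dimensional space, hence continuous, so it may be applied to the matrix series
  term by term. By the previous lemma the terms become those of the scalar series times \<open>v\<close>.
\<close>

lemma mittag_leffler_matrix_eigenvector:
  fixes M :: "real^'n^'n"
  assumes "\<alpha> > 0" and "map_matrix complex_of_real M *v v = \<mu> *s v"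
  shows "map_matrix complex_of_real (mittag_leffler_matrix \<alpha> M) *v v = mittag_leffler \<alpha> \<mu> *s v"
proof -
  let ?c = "\<lambda>k. 1 / Gamma (\<alpha> * real k + 1)"
  let ?L = "\<lambda>X :: real^'n^'n. map_matrix complex_of_real X *v v"
  have "linear ?L"
  proof (rule linearI)
    show "?L (X + Y) = ?L X + ?L Y" for X Y
      by (simp add: vec_eq_iff matrix_vector_mult_def distrib_right sum.distrib)
    show "?L (r *\<^sub>R X) = r *\<^sub>R ?L X" for r X
      by (simp add: vec_eq_iff matrix_vector_mult_def scaleR_sum_right)
        (simp add: scaleR_conv_of_real[where 'a = complex] mult.assoc)
  qed
  then have L: "bounded_linear ?L"
    by (simp add: linear_conv_bounded_linear)
  let ?f = "\<lambda>k. \<mu> ^ k / of_real (Gamma (\<alpha> * real k + 1))"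
  have L_term: "?L (?c k *\<^sub>R matrix_power M k) = ?f k *s v" for k
  proof -
    have "?L (?c k *\<^sub>R matrix_power M k) = ?c k *\<^sub>R (\<mu> ^ k *s v)"
      using linear_cmul[OF \<open>linear ?L\<close>] complexify_matrix_power_eigenvector[OF assms(2)]
      by metis
    then show ?thesis
      by (simp add: vec_eq_iff scaleR_conv_of_real[where 'a = complex])
  qed
  have "(\<lambda>k. ?c k *\<^sub>R matrix_power M k) sums mittag_leffler_matrix \<alpha> M"
    unfolding mittag_leffler_matrix_def
    by (rule summable_sums[OF summable_mittag_leffler_matrix[OF assms(1)]])
  from bounded_linear.sums[OF L this]
  have *: "(\<lambda>k. ?f k *s v) sums ?L (mittag_leffler_matrix \<alpha> M)"
    by (simp only: L_term)
  have "norm (?f k) = norm \<mu> ^ k / Gamma (\<alpha> * real k + 1)" for k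
  proof -
    have "Gamma (\<alpha> * real k + 1) > 0"
      using assms(1) by (intro Gamma_real_pos) (simp add: add_nonneg_pos)
    then show ?thesis by (simp add: norm_divide norm_power)
  qed
  then have "summable (\<lambda>k. norm (?f k))"
    using summable_mittag_leffler_majorant[OF assms(1), of "norm \<mu>"] by simp
  then have f: "?f sums mittag_leffler \<alpha> \<mu>"
    unfolding mittag_leffler_def by (rule summable_sums[OF summable_norm_cancel])
  have "bounded_linear (\<lambda>z :: complex. z *s v)"
    unfolding linear_conv_bounded_linear[symmetric]
    by (rule linearI) (simp_all add: vec_eq_iff algebra_simps)
  then have "(\<lambda>k. ?f k *s v) sums (mittag_leffler \<alpha> \<mu> *s v)"
    using f by (rule bounded_linear.sums)
  with * show ?thesis by (rule sums_unique2)
qed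

text \<open>
  The real and imaginary parts of a complex null vector of a real matrix are real null vectors.
\<close>

lemma matrix_kernel_nontrivial_if_complex:
  fixes M :: "real^'n^'m"
  assumes "map_matrix complex_of_real M *v v = 0" and "v \<noteq> 0"
  shows "matrix_kernel M \<noteq> {0}"
proof -
  define a b where "a = (\<chi> j. Re (v $ j))" and "b = (\<chi> j. Im (v $ j))"
  have *: "(\<Sum>j\<in>UNIV. complex_of_real (M $ i $ j) * v $ j) = 0" for i
    using assms(1) by (simp add: vec_eq_iff map_matrix_def matrix_vector_mult_def)
  have "M *v a = 0" "M *v b = 0"
    using arg_cong[OF *, of Re] arg_cong[OF *, of Im]
    by (simp_all add: a_def b_def vec_eq_iff matrix_vector_mult_def)
  moreover have "a \<noteq> 0 \<or> b \<noteq> 0"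
    using assms(2) by (auto simp: a_def b_def vec_eq_iff complex_eq_iff)
  ultimately show ?thesis by (auto simp: matrix_kernel_def)
qed

theorem theorem6:
  fixes \<alpha> T :: real and A :: "real^'n^'n" and \<zeta> :: complex
  assumes "0 < \<alpha>" and "\<alpha> < 1" and "T > 0"
    and "mittag_leffler \<alpha> \<zeta> = 0"
    and "complex_eigenvalue A (\<zeta> / complex_of_real (T powr \<alpha>))"
  shows "matrix_kernel (mittag_leffler_matrix \<alpha> ((T powr \<alpha>) *\<^sub>R A)) \<noteq> {0}
    \<and> (\<forall>z0 \<in> matrix_kernel (mittag_leffler_matrix \<alpha> ((T powr \<alpha>) *\<^sub>R A)).
        \<forall>p \<in> range (\<lambda>x :: real^'n. mittag_leffler_matrix \<alpha> ((T powr \<alpha>) *\<^sub>R A) *v x).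
          \<exists>x0 :: real^'n. trajectory \<alpha> A T (x0 + z0) = p)"
proof (intro conjI ballI)
  let ?s = "T powr \<alpha>"
  let ?E = "mittag_leffler_matrix \<alpha> (?s *\<^sub>R A)"
  obtain v where v: "v \<noteq> 0"
    "map_matrix complex_of_real A *v v = (\<zeta> / complex_of_real ?s) *s v"
    using assms(5) unfolding complex_eigenvalue_def by blast
  have "map_matrix complex_of_real (?s *\<^sub>R A) *v v
      = complex_of_real ?s *s (map_matrix complex_of_real A *v v)"
    by (simp add: vec_eq_iff map_matrix_def matrix_vector_mult_def sum_distrib_left mult.assoc)
  also have "\<dots> = \<zeta> *s v"
    using assms(3) v(2) by simp
  finally have "map_matrix complex_of_real ?E *v v = 0"
    using mittag_leffler_matrix_eigenvector assms(1,4) by (metis vector_smult_lzero)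
  then show "matrix_kernel ?E \<noteq> {0}"
    using v(1) by (rule matrix_kernel_nontrivial_if_complex)
  fix z0 p
  assume z0: "z0 \<in> matrix_kernel ?E" and "p \<in> range (\<lambda>x :: real^'n. ?E *v x)"
  then obtain x where "p = ?E *v x" by blast
  with z0 have "trajectory \<alpha> A T (x + z0) = p"
    by (simp add: trajectory_def matrix_kernel_def matrix_vector_right_distrib)
  then show "\<exists>x0. trajectory \<alpha> A T (x0 + z0) = p" ..
qed

end
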